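(* Let $A\in\mathbb{R}^{N\times N}$ and $v\in\mathbb{R}^N$. Let $\widehat{\omega}=\frac{N}{\mathbb{E}[T]}\omega$, where $\omega\in\mathbb{R}$ is the scalar parameter associated with a convergent classical Richardson iteration for $Az=v$. Let $\widehat{z}_m$ and $z_m$ be the $m$th iterates generated by the straggler-tolerant Richardson iteration $$\widehat{z}_i=(I-\widehat{\omega}D_{{\cal T}_i}A)\widehat{z}_{i-1}+\omega v,\qquad i=1,\ldots,m,$$ and by the classical Richardson iteration $$z_i=(I-\omega A)z_{i-1}+\omega v,\qquad i=1,\ldots,m,$$ respectively. If $\widehat{z}_0=z_0=f$ for some $f\in\mathbb{R}^N$, then $$\mathbb{E}\left[\widehat{z}_m\right]=z_m.$$
   Context: $T$ is a random integer with an arbitrary distribution on $\{1,\ldots,N\}$, and ${\cal T}$ is a random subset of $\{1,\ldots,N\}$ with $|{\cal T}|=T$ such that, conditionally on $T=t$, each of the $\binom{N}{t}$ subsets of cardinality $t$ is chosen with probability $\binom{N}{t}^{-1}$. The pairs $(T_1,{\cal T}_1),\ldots,(T_m,{\cal T}_m)$ are independent and identically distributed copies of $(T,{\cal T})$. $I$ is the $N\times N$ identity matrix, $e_j$ is its $j$th column, and $D_{{\cal T}_i}=\sum_{j\in{\cal T}_i}e_je_j^{\top}$. The data $A,v,\omega,f$ are deterministic. The classical Richardson iteration with parameter $\omega$ is convergent when $\rho(I-\omega A)<1$, where $\rho$ denotes the spectral radius. *)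

theory Defs
  imports "HOL-Probability.Probability"
begin

text \<open>
  Vectors are \<open>real ^ 'n\<close> with \<open>N = CARD('n)\<close>; the finite type \<open>'n\<close> plays the role of the
  index set \<open>{1, \<dots>, N}\<close>.
\<close>

definition eigenvalue :: "complex ^ 'n ^ 'n \<Rightarrow> complex \<Rightarrow> bool" where
  "eigenvalue B c \<longleftrightarrow> (\<exists>x. x \<noteq> 0 \<and> B *v x = c *s x)"

text \<open>The eigenvalues of a real matrix are taken over the complex numbers.\<close>

definition spectral_radius :: "real ^ 'n ^ 'n \<Rightarrow> real" where
  "spectral_radius B = Max (cmod ` {c. eigenvalue (map_matrix complex_of_real B) c})"

text \<open>The sum of the \<open>N \<times> N\<close> matrices \<open>e\<^sub>j e\<^sub>j\<^sup>T\<close> over \<open>j \<in> J\<close>.\<close>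

definition sel_matrix :: "'n set \<Rightarrow> real ^ 'n ^ 'n" where
  "sel_matrix J =
    (\<Sum>j\<in>J. (columnvector (axis j 1) :: real ^ 1 ^ 'n) ** (rowvector (axis j 1) :: real ^ 'n ^ 1))"

text \<open>
  \<open>T\<close> has an arbitrary distribution on \<open>{1, \<dots>, N}\<close>; conditionally on any value \<open>t\<close> that \<open>T\<close>
  takes with positive probability, \<open>S\<close> is uniform on the subsets of cardinality \<open>t\<close>.
\<close>

definition uniform_subset_of_random_size ::
    "'a measure \<Rightarrow> ('a \<Rightarrow> nat) \<Rightarrow> ('a \<Rightarrow> 'n::finite set) \<Rightarrow> bool" where
  "uniform_subset_of_random_size M T S \<longleftrightarrow>
     T \<in> measurable M (count_space UNIV) \<and>
     S \<in> measurable M (count_space UNIV) \<and>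
     (AE x in M. T x \<in> {1..CARD('n)}) \<and>
     (AE x in M. card (S x) = T x) \<and>
     (\<forall>t J. \<P>(x in M. T x = t) > 0 \<longrightarrow> card J = t \<longrightarrow>
        \<P>(x in M. S x = J \<bar> T x = t) = 1 / real (CARD('n) choose t))"

text \<open>
  Only for discrete random variables: the \<open>\<sigma>\<close>-algebra on the values is the power set.
  Measurability of every \<open>Y i\<close> is part of \<open>indep_vars\<close>.
\<close>

definition iid_copies :: "'a measure \<Rightarrow> ('a \<Rightarrow> 'b) \<Rightarrow> 'i set \<Rightarrow> ('i \<Rightarrow> 'a \<Rightarrow> 'b) \<Rightarrow> bool" where
  "iid_copies M X I Y \<longleftrightarrow>
     prob_space.indep_vars M (\<lambda>_. count_space UNIV) Y I \<and>
     (\<forall>i\<in>I. distr M (count_space UNIV) (Y i) = distr M (count_space UNIV) X)"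

end

theory Submission
  imports Defs
begin

text \<open>
  Every index is contained in the random subset with the same probability \<open>p = E[T] / N\<close>.
  Indeed the law of the subset depends only on cardinality, so it is invariant under
  permutations of the indices and the \<open>N\<close> inclusion probabilities agree
  (\<open>inclusion_prob_eq\<close>); their sum is the expected cardinality \<open>E[T]\<close> (\<open>inclusion_prob\<close>).
  Hence the random diagonal matrix has expectation \<open>p I\<close>, and the factor \<open>N / E[T]\<close> in
  the rescaled parameter cancels \<open>p\<close> exactly.

  The iterate after \<open>k\<close> steps is a function of the first \<open>k\<close> subsets alone, hence is
  independent of the subset used in the next step. Therefore the expectation of
  \<open>D A z\<close> factors as \<open>p A E[z]\<close> (\<open>integral_sel_matrix_mult_vec\<close>), so the expected iterates
  satisfy the classical recursion, and induction on the step finishes the proof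
  (\<open>integral_straggler_iterate\<close>).
\<close>

section \<open>The selection matrix\<close>

lemma sel_matrix_nth:
  fixes J :: "'n::finite set"
  shows "sel_matrix J $ a $ b = (if a = b \<and> a \<in> J then 1 else 0)"
proof -
  have "((columnvector (axis j 1) :: real ^ 1 ^ 'n) ** (rowvector (axis j 1) :: real ^ 'n ^ 1)) $ a $ b
      = (if j = a then (if a = b then 1 else 0) else 0)" for j
    by (auto simp: matrix_matrix_mult_def columnvector_def rowvector_def axis_def)
  then show ?thesis by (simp add: sel_matrix_def sum_component)
qed

text \<open>
  In this form the randomness of the subset enters only through real-valued indicators
  multiplying fixed basis vectors, so that scalar facts on independence and measurability apply.
\<close>

lemma sel_matrix_mult_vec:
  "sel_matrix J *v w = (\<Sum>j\<in>UNIV. (indicator {K. j \<in> K} J * (w $ j)) *\<^sub>R axis j 1)"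
  by (simp add: vec_eq_iff matrix_vector_mult_def sel_matrix_nth axis_def sum_component
      indicator_def if_distrib[where f="\<lambda>t. t * _"] if_distrib[where f="\<lambda>t. _ * t"]
      sum.If_cases cong: if_cong)

section \<open>Inclusion probabilities\<close>

text \<open>
  Almost surely \<open>S = L\<close> forces \<open>T = card L\<close>, so the probability of \<open>S = L\<close> is the mass of
  \<open>T\<close> at \<open>card L\<close> times the conditional uniform probability, both functions of \<open>card L\<close>.
  Sizes of mass zero need a separate argument because the conditional law says nothing
  about them.
\<close>

lemma (in prob_space) prob_subset_eq_if_card_eq:
  fixes S :: "'a \<Rightarrow> 'n::finite set"
  assumes unif: "uniform_subset_of_random_size M T S" and card: "card J = card K"
  shows "\<P>(x in M. S x = J) = \<P>(x in M. S x = K)"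
proof -
  have T [measurable]: "T \<in> measurable M (count_space UNIV)"
    and S [measurable]: "S \<in> measurable M (count_space UNIV)"
    and ae: "AE x in M. card (S x) = T x"
    using unif by (auto simp: uniform_subset_of_random_size_def)
  have joint: "\<P>(x in M. S x = L) = \<P>(x in M. S x = L \<and> T x = card L)" for L
    by (rule finite_measure_eq_AE) (use ae in auto)
  show ?thesis
  proof (cases "\<P>(x in M. T x = card J) > 0")
    case True
    have "\<P>(x in M. S x = L \<bar> T x = card J) = 1 / real (CARD('n) choose card J)"
      if "card L = card J" for L
      using unif True that unfolding uniform_subset_of_random_size_def by blast
    from this[of J] this[of K] show ?thesis
      using True card unfolding joint[of J] joint[of K] cond_prob_def
      by (auto simp: field_simps)
  next
    case False
    then have "\<P>(x in M. T x = card J) = 0"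
      by (simp add: zero_less_measure_iff)
    moreover have "\<P>(x in M. S x = L \<and> T x = card J) \<le> \<P>(x in M. T x = card J)" for L
      by (rule finite_measure_mono) auto
    ultimately have "\<P>(x in M. S x = L \<and> T x = card J) = 0" for L
      by (simp add: measure_le_0_iff)
    then show ?thesis
      using card unfolding joint[of J] joint[of K] by simp
  qed
qed

text \<open>
  Exchanging \<open>j\<close> and \<open>k\<close> is a cardinality-preserving bijection from the subsets containing
  \<open>j\<close> to those containing \<open>k\<close>. This symmetry avoids any computation with binomial coefficients.
\<close>

lemma (in prob_space) inclusion_prob_eq:
  fixes S :: "'a \<Rightarrow> 'n::finite set"
  assumes unif: "uniform_subset_of_random_size M T S"
  shows "\<P>(x in M. j \<in> S x) = \<P>(x in M. k \<in> S x)"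
proof -
  have [measurable]: "S \<in> measurable M (count_space UNIV)"
    using unif by (auto simp: uniform_subset_of_random_size_def)
  have decomp: "\<P>(x in M. i \<in> S x) = (\<Sum>J\<in>{J. i \<in> J}. \<P>(x in M. S x = J))" for i
  proof -
    have "{x \<in> space M. i \<in> S x} = (\<Union>J\<in>{J. i \<in> J}. {x \<in> space M. S x = J})" by auto
    then show ?thesis
      by (simp only:) (rule finite_measure_finite_Union, auto simp: disjoint_family_on_def)
  qed
  let ?\<tau> = "Transposition.transpose j k"
  have "bij_betw ((`) ?\<tau>) {J. j \<in> J} {J. k \<in> J}"
    by (rule bij_betw_byWitness[where f'="(`) ?\<tau>"])
      (auto simp: image_image image_iff intro: transpose_apply_first[symmetric]
         transpose_apply_second[symmetric] bexI[rotated])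
  then have "(\<Sum>J\<in>{J. k \<in> J}. \<P>(x in M. S x = J))
      = (\<Sum>J\<in>{J. j \<in> J}. \<P>(x in M. S x = ?\<tau> ` J))"
    by (rule sum.reindex_bij_betw[symmetric])
  also have "\<dots> = (\<Sum>J\<in>{J. j \<in> J}. \<P>(x in M. S x = J))"
    by (intro sum.cong refl prob_subset_eq_if_card_eq[OF unif] card_image)
      (auto intro: inj_on_inverseI[where g="?\<tau>"])
  finally show ?thesis by (simp only: decomp)
qed

text \<open>Double counting: the cardinality of \<open>S\<close> is the sum of the indicators of \<open>k \<in> S\<close>.\<close>

lemma (in prob_space) inclusion_prob:
  fixes S :: "'a \<Rightarrow> 'n::finite set"
  assumes unif: "uniform_subset_of_random_size M T S"
  shows "\<P>(x in M. j \<in> S x) = (\<integral>x. real (T x) \<partial>M) / real CARD('n)"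
proof -
  have [measurable]: "S \<in> measurable M (count_space UNIV)" "T \<in> measurable M (count_space UNIV)"
    and ae: "AE x in M. card (S x) = T x"
    using unif by (auto simp: uniform_subset_of_random_size_def)
  have "(\<integral>x. real (T x) \<partial>M) = (\<integral>x. (\<Sum>k\<in>UNIV. indicator {x \<in> space M. k \<in> S x} x) \<partial>M)"
  proof (rule integral_cong_AE)
    show "AE x in M. real (T x) = (\<Sum>k\<in>UNIV. indicator {x \<in> space M. k \<in> S x} x)"
      using ae
    proof (rule AE_mp, intro AE_I2 impI)
      fix x assume "x \<in> space M" "card (S x) = T x"
      then show "real (T x) = (\<Sum>k\<in>UNIV. indicator {x \<in> space M. k \<in> S x} x)"
        by (simp add: indicator_def sum.If_cases)
    qed
  qed measurable
  also have "\<dots> = (\<Sum>k\<in>UNIV. \<P>(x in M. k \<in> S x))"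
    by (subst Bochner_Integration.integral_sum) (auto simp: less_top[symmetric] Int_absorb1)
  also have "\<dots> = (\<Sum>k\<in>(UNIV::'n set). \<P>(x in M. j \<in> S x))"
    by (intro sum.cong refl inclusion_prob_eq[OF unif])
  finally show ?thesis by simp
qed

text \<open>The rescaling by \<open>N / E[T]\<close> is a genuine division because \<open>T \<ge> 1\<close> almost surely.\<close>

lemma (in prob_space) expectation_size_pos:
  fixes S :: "'a \<Rightarrow> 'n::finite set"
  assumes unif: "uniform_subset_of_random_size M T S"
  shows "(\<integral>x. real (T x) \<partial>M) > 0"
proof -
  have [measurable]: "T \<in> measurable M (count_space UNIV)"
    and ae: "AE x in M. T x \<in> {1..CARD('n)}"
    using unif by (auto simp: uniform_subset_of_random_size_def)
  have "integrable M (\<lambda>x. real (T x))"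
    by (rule integrable_const_bound[where B="real CARD('n)"]) (use ae in auto)
  then have "1 \<le> (\<integral>x. real (T x) \<partial>M)"
    by (rule integral_ge_const) (use ae in auto)
  then show ?thesis by simp
qed

section \<open>Expectation of the straggler-tolerant iterates\<close>

text \<open>
  The independence of \<open>X\<close> and \<open>Y\<close> is expressed through coordinates and indicators, because
  \<open>indep_var\<close> relates only variables with values in the same type. Each coordinate of the
  product is an indicator times a coordinate of \<open>X\<close>, and its expectation factors.
\<close>

lemma (in prob_space) integral_sel_matrix_mult_vec:
  fixes X :: "'a \<Rightarrow> real ^ 'n::finite" and Y :: "'a \<Rightarrow> 'n set"
  assumes Y [measurable]: "Y \<in> measurable M (count_space UNIV)" and X: "integrable M X"
    and ind: "\<And>j. indep_var borel (\<lambda>x. indicator {K. j \<in> K} (Y x)) borel (\<lambda>x. X x $ j)"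
    and p: "\<And>j. \<P>(x in M. j \<in> Y x) = p"
  shows "integrable M (\<lambda>x. sel_matrix (Y x) *v X x)" (is ?I)
    and "(\<integral>x. sel_matrix (Y x) *v X x \<partial>M) = p *\<^sub>R (\<integral>x. X x \<partial>M)" (is ?E)
proof -
  define d where "d j x = (indicator {K. j \<in> K} (Y x) :: real)" for j x
  have d_eq: "d j x = indicator {x \<in> space M. j \<in> Y x} x" if "x \<in> space M" for j x
    using that by (auto simp: d_def indicator_def)
  have [measurable]: "d j \<in> borel_measurable M" for j
    unfolding d_def by (rule measurable_compose[OF Y]) simp
  have d_int: "integrable M (d j)" for j
    by (rule integrable_const_bound[where B=1]) (auto simp: d_def indicator_def)
  have d_exp: "(\<integral>x. d j x \<partial>M) = p" for j
    by (subst Bochner_Integration.integral_cong[OF refl d_eq]) (auto simp: p Int_absorb1)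
  have X_int: "integrable M (\<lambda>x. X x $ j)" for j
    using X by (rule integrable_bounded_linear[OF bounded_linear_vec_nth])
  have X_exp: "(\<integral>x. X x $ j \<partial>M) = (\<integral>x. X x \<partial>M) $ j" for j
    using X by (rule integral_bounded_linear[OF bounded_linear_vec_nth])
  have dX: "indep_var borel (d j) borel (\<lambda>x. X x $ j)" for j
    using ind by (simp add: d_def[abs_def])
  have int: "integrable M (\<lambda>x. (d j x * X x $ j) *\<^sub>R axis j (1::real))" for j
    by (intro integrable_scaleR_left indep_var_integrable dX d_int X_int)
  have eq: "sel_matrix (Y x) *v X x = (\<Sum>j\<in>UNIV. (d j x * X x $ j) *\<^sub>R axis j 1)" for x
    by (simp add: sel_matrix_mult_vec d_def)
  show ?I unfolding eq by (intro Bochner_Integration.integrable_sum int)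
  have "(\<integral>x. sel_matrix (Y x) *v X x \<partial>M)
      = (\<Sum>j\<in>UNIV. (\<integral>x. (d j x * X x $ j) *\<^sub>R axis j 1 \<partial>M))"
    unfolding eq by (intro Bochner_Integration.integral_sum int)
  also have "\<dots> = (\<Sum>j\<in>UNIV. (p * (\<integral>x. X x \<partial>M) $ j) *\<^sub>R axis j 1)"
    by (simp add: indep_var_integrable[OF dX d_int X_int]
        indep_var_lebesgue_integral[OF dX d_int X_int] d_exp X_exp)
  also have "\<dots> = p *\<^sub>R (\<integral>x. X x \<partial>M)"
    by (simp add: vec_eq_iff axis_def sum_component if_distrib[where f="\<lambda>t. _ * t"] cong: if_cong)
  finally show ?E .
qed

text \<open>
  The recursion is run on one fixed sequence \<open>Y\<close> of subsets, so that the random iterate appears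
  as a deterministic function of the sequence; this makes its dependence on finitely many of
  the subsets explicit. The matrix product is expanded so that the random matrix acts on a vector.
\<close>

primrec straggler_iterate ::
    "real \<Rightarrow> real ^ 'n ^ 'n \<Rightarrow> real ^ 'n \<Rightarrow> real ^ 'n \<Rightarrow> (nat \<Rightarrow> 'n set) \<Rightarrow> nat \<Rightarrow> real ^ 'n" where
  "straggler_iterate c A b f Y 0 = f"
| "straggler_iterate c A b f Y (Suc k) =
     straggler_iterate c A b f Y k
       - c *\<^sub>R (sel_matrix (Y (Suc k)) *v (A *v straggler_iterate c A b f Y k)) + b"

lemma straggler_iterate_cong:
  "(\<And>i. i \<in> {1..k} \<Longrightarrow> Y i = Y' i) \<Longrightarrow>
     straggler_iterate c A b f Y k = straggler_iterate c A b f Y' k"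
  by (induction k) auto

lemma measurable_straggler_iterate:
  assumes "{1..k} \<subseteq> L"
  shows "(\<lambda>Y. straggler_iterate c A b f Y k) \<in>
           borel_measurable (PiM L (\<lambda>_. count_space (UNIV :: 'n::finite set set)))"
  using assms
proof (induction k)
  case 0
  then show ?case by simp
next
  case (Suc k)
  let ?P = "PiM L (\<lambda>_. count_space (UNIV :: 'n set set))"
  have [measurable]: "(\<lambda>Y. straggler_iterate c A b f Y k) \<in> borel_measurable ?P"
    using Suc.prems by (intro Suc.IH) (auto simp: subset_iff)
  have A_nth: "(\<lambda>Y. (A *v straggler_iterate c A b f Y k) $ j) \<in> borel_measurable ?P" for j
    by (rule borel_measurable_continuous_on[where f="\<lambda>u. (A *v u) $ j"])
      (auto intro!: linear_continuous_on
        bounded_linear_compose[OF bounded_linear_vec_nth matrix_vector_mul_bounded_linear])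
  have "(\<lambda>Y. Y (Suc k)) \<in> measurable ?P (count_space UNIV)"
    by (rule measurable_component_singleton) (use Suc.prems in auto)
  then have "(\<lambda>Y. indicator {K. j \<in> K} (Y (Suc k)) :: real) \<in> borel_measurable ?P" for j
    by (rule measurable_compose) simp
  with A_nth show ?case
    unfolding straggler_iterate.simps sel_matrix_mult_vec
    by (intro borel_measurable_add borel_measurable_diff borel_measurable_scaleR
        borel_measurable_sum borel_measurable_times borel_measurable_const) auto
qed

text \<open>
  The iterate after \<open>k\<close> steps is a function of \<open>Y 1, \<dots>, Y k\<close>, a block disjoint from \<open>Y (Suc k)\<close>.
  The maps \<open>h\<close> and \<open>g\<close> bring the subset and the iterate into a common value space, as
  \<open>indep_var\<close> requires.
\<close>

lemma (in prob_space) indep_var_straggler_iterate: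
  fixes Y :: "nat \<Rightarrow> 'a \<Rightarrow> 'n::finite set"
  assumes ind: "indep_vars (\<lambda>_. count_space UNIV) Y {1..m}" and k: "Suc k \<le> m"
    and h: "h \<in> measurable (count_space UNIV) N" and g: "g \<in> measurable borel N"
  shows "indep_var N (\<lambda>x. h (Y (Suc k) x)) N (\<lambda>x. g (straggler_iterate c A b f (\<lambda>i. Y i x) k))"
proof -
  let ?past = "\<lambda>x. restrict (\<lambda>i. Y i x) {1..k}" and ?next = "\<lambda>x. restrict (\<lambda>i. Y i x) {Suc k}"
  have "indep_var (PiM {Suc k} (\<lambda>_. count_space UNIV)) ?next
          (PiM {1..k} (\<lambda>_. count_space UNIV)) ?past"
    by (rule indep_var_restrict[OF ind]) (use k in auto)
  moreover have "(\<lambda>Z. h (Z (Suc k))) \<in> measurable (PiM {Suc k} (\<lambda>_. count_space UNIV)) N"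
    by (rule measurable_compose[OF _ h]) (rule measurable_component_singleton, simp)
  moreover have "(\<lambda>Z. g (straggler_iterate c A b f Z k))
      \<in> measurable (PiM {1..k} (\<lambda>_. count_space UNIV)) N"
    by (rule measurable_compose[OF measurable_straggler_iterate g]) simp
  ultimately have "indep_var N ((\<lambda>Z. h (Z (Suc k))) \<circ> ?next)
          N ((\<lambda>Z. g (straggler_iterate c A b f Z k)) \<circ> ?past)"
    by (rule indep_var_compose)
  moreover have "straggler_iterate c A b f (?past x) k
      = straggler_iterate c A b f (\<lambda>i. Y i x) k" for x
    by (rule straggler_iterate_cong) simp
  ultimately show ?thesis by (simp add: comp_def)
qed

text \<open>
  Taking expectations in one step replaces the random matrix by \<open>p\<close> times the identity, so the
  mean follows a deterministic Richardson iteration with parameter \<open>c * p\<close>. Integrability has to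
  be carried along in the induction, since the product rule for independent variables needs it.
\<close>

lemma (in prob_space) integral_straggler_iterate:
  fixes Y :: "nat \<Rightarrow> 'a \<Rightarrow> 'n::finite set"
  assumes ind: "indep_vars (\<lambda>_. count_space UNIV) Y {1..m}"
    and p: "\<And>i j. i \<in> {1..m} \<Longrightarrow> \<P>(x in M. j \<in> Y i x) = p"
    and z0: "z 0 = f"
    and z: "\<And>i. i \<in> {1..m} \<Longrightarrow> z i = (mat 1 - (c * p) *\<^sub>R A) *v z (i - 1) + b"
    and "k \<le> m"
  shows "integrable M (\<lambda>x. straggler_iterate c A b f (\<lambda>i. Y i x) k)
       \<and> (\<integral>x. straggler_iterate c A b f (\<lambda>i. Y i x) k \<partial>M) = z k"
  using \<open>k \<le> m\<close>
proof (induction k)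
  case 0
  then show ?case by (simp add: z0 prob_space)
next
  case (Suc k)
  let ?X = "\<lambda>x. straggler_iterate c A b f (\<lambda>i. Y i x) k"
  have IH: "integrable M ?X" "(\<integral>x. ?X x \<partial>M) = z k" using Suc by auto
  have A_lin: "bounded_linear ((*v) A)" by (rule matrix_vector_mul_bounded_linear)
  have AX: "integrable M (\<lambda>x. A *v ?X x)" "(\<integral>x. A *v ?X x \<partial>M) = A *v z k"
    using integrable_bounded_linear[OF A_lin IH(1)] integral_bounded_linear[OF A_lin IH(1)] IH(2)
    by auto
  have "(\<lambda>u. (A *v u) $ j) \<in> borel_measurable borel" for j
    by (intro borel_measurable_continuous_onI linear_continuous_on
        bounded_linear_compose[OF bounded_linear_vec_nth A_lin])
  then have "indep_var borel (\<lambda>x. indicator {K. j \<in> K} (Y (Suc k) x)) borel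
      (\<lambda>x. (A *v ?X x) $ j)" for j
    by (intro indep_var_straggler_iterate[OF ind Suc.prems]) auto
  moreover have "Y (Suc k) \<in> measurable M (count_space UNIV)"
    using ind Suc.prems by (auto simp: indep_vars_def)
  ultimately have sel: "integrable M (\<lambda>x. sel_matrix (Y (Suc k) x) *v (A *v ?X x))"
    "(\<integral>x. sel_matrix (Y (Suc k) x) *v (A *v ?X x) \<partial>M) = p *\<^sub>R (A *v z k)"
    using integral_sel_matrix_mult_vec[of "Y (Suc k)" "\<lambda>x. A *v ?X x" p] AX p Suc.prems
    by auto
  have "z (Suc k) = z k - (c * p) *\<^sub>R (A *v z k) + b"
    using z[of "Suc k"] Suc.prems
    by (simp add: matrix_vector_mult_diff_rdistrib scaleR_matrix_vector_assoc)
  with sel IH Suc.prems show ?case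
    by (simp add: prob_space)
qed

theorem theorem3p5:
  fixes M :: "'a measure"
    and T :: "'a \<Rightarrow> nat" and S :: "'a \<Rightarrow> 'n::finite set"
    and Ts :: "nat \<Rightarrow> 'a \<Rightarrow> nat" and Ss :: "nat \<Rightarrow> 'a \<Rightarrow> 'n set"
    and A :: "real ^ 'n ^ 'n" and v f :: "real ^ 'n"
    and omega omega_hat :: real and m :: nat
    and z_hat :: "nat \<Rightarrow> 'a \<Rightarrow> real ^ 'n" and z :: "nat \<Rightarrow> real ^ 'n"
  assumes "prob_space M"
    and "uniform_subset_of_random_size M T S"
    and "iid_copies M (\<lambda>x. (T x, S x)) {1..m} (\<lambda>i x. (Ts i x, Ss i x))"
    and "spectral_radius (mat 1 - omega *\<^sub>R A) < 1"
    and "omega_hat = real CARD('n) / (\<integral>x. real (T x) \<partial>M) * omega"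
    and "\<And>x. x \<in> space M \<Longrightarrow> z_hat 0 x = f"
    and "\<And>i x. i \<in> {1..m} \<Longrightarrow> x \<in> space M \<Longrightarrow>
           z_hat i x = (mat 1 - omega_hat *\<^sub>R (sel_matrix (Ss i x) ** A)) *v z_hat (i - 1) x
                       + omega *\<^sub>R v"
    and "z 0 = f"
    and "\<And>i. i \<in> {1..m} \<Longrightarrow> z i = (mat 1 - omega *\<^sub>R A) *v z (i - 1) + omega *\<^sub>R v"
  shows "integrable M (z_hat m) \<and> (\<integral>x. z_hat m x \<partial>M) = z m"
proof -
  interpret prob_space M by fact
  note unif = assms(2) and iid = assms(3)
  let ?p = "(\<integral>x. real (T x) \<partial>M) / real CARD('n)"
  have pair: "indep_vars (\<lambda>_. count_space UNIV) (\<lambda>i x. (Ts i x, Ss i x)) {1..m}"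
    and dist: "\<And>i. i \<in> {1..m} \<Longrightarrow> distr M (count_space UNIV) (\<lambda>x. (Ts i x, Ss i x))
                 = distr M (count_space UNIV) (\<lambda>x. (T x, S x))"
    using iid by (auto simp: iid_copies_def)
  have ind: "indep_vars (\<lambda>_. count_space UNIV) Ss {1..m}"
    using indep_vars_compose2[OF pair, of "\<lambda>_. snd" "\<lambda>_. count_space UNIV"] by simp
  \<comment> \<open>The inclusion probability depends only on the law, so the copies inherit it.\<close>
  have p: "\<P>(x in M. j \<in> Ss i x) = ?p" if i: "i \<in> {1..m}" for i j
  proof -
    have [measurable]: "T \<in> measurable M (count_space UNIV)" "S \<in> measurable M (count_space UNIV)"
      using unif by (auto simp: uniform_subset_of_random_size_def)
    have TS: "(\<lambda>x. (T x, S x)) \<in> measurable M (count_space UNIV)"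
      by measurable
    have TSi: "(\<lambda>x. (Ts i x, Ss i x)) \<in> measurable M (count_space UNIV)"
      using pair i by (auto simp: indep_vars_def)
    let ?B = "{q :: nat \<times> 'n set. j \<in> snd q}"
    have "\<P>(x in M. j \<in> Ss i x) = measure (distr M (count_space UNIV) (\<lambda>x. (Ts i x, Ss i x))) ?B"
      by (subst measure_distr[OF TSi]) (auto intro: arg_cong[where f="measure M"])
    also have "\<dots> = \<P>(x in M. j \<in> S x)"
      unfolding dist[OF i]
      by (subst measure_distr[OF TS]) (auto intro: arg_cong[where f="measure M"])
    finally show ?thesis using inclusion_prob[OF unif] by simp
  qed
  have "omega_hat * ?p = omega"
    using expectation_size_pos[OF unif] by (simp add: assms(5))
  then have main: "integrable M (\<lambda>x. straggler_iterate omega_hat A (omega *\<^sub>R v) f (\<lambda>i. Ss i x) m)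
      \<and> (\<integral>x. straggler_iterate omega_hat A (omega *\<^sub>R v) f (\<lambda>i. Ss i x) m \<partial>M) = z m"
    using integral_straggler_iterate[OF ind p, of z f omega_hat A "omega *\<^sub>R v" m] assms(8,9)
    by simp
  have "z_hat k x = straggler_iterate omega_hat A (omega *\<^sub>R v) f (\<lambda>i. Ss i x) k"
    if "x \<in> space M" "k \<le> m" for k x
    using \<open>k \<le> m\<close>
  proof (induction k)
    case 0
    then show ?case using assms(6) that by simp
  next
    case (Suc k)
    then show ?case
      using assms(7)[of "Suc k" x] that
      by (simp add: matrix_vector_mult_diff_rdistrib matrix_vector_mul_assoc
          flip: scaleR_matrix_vector_assoc)
  qed
  then have "\<And>x. x \<in> space M \<Longrightarrow>
      z_hat m x = straggler_iterate omega_hat A (omega *\<^sub>R v) f (\<lambda>i. Ss i x) m"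
    by simp
  with main show ?thesis
    by (simp cong: Bochner_Integration.integrable_cong Bochner_Integration.integral_cong)
qed

end
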